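(* Let $n\ge2$, and let $0<r<1$ with $r^2<1/5$. Then the function $\alpha\mapsto\mu_r(\alpha)=\sup_{f\in\mathcal F_{\alpha,r}}|\nabla J_f(0)|$ is locally Lipschitz on $\alpha>0$, and at every $\alpha>0$ where the derivative exists, $$\alpha\,\mu_r'(\alpha)\le C(r)\,\mu_r(\alpha),\qquad C(r)=\frac{1-r^2}{1-5r^2}.$$
   Context: $\mathbb P^n=\{z\in\mathbb C^n:|z_i|<1,\ i=1,\dots,n\}$; $|\cdot|$ is the Euclidean norm and $|z|_\infty=\max_i|z_i|$. For a locally biholomorphic $f=(f_1,\dots,f_n)$ with complex Jacobian determinant $J_f=\det Df$, the Schwarzian derivatives are $$S^k_{ij}f=\sum_{l=1}^n\frac{\partial^2 f_l}{\partial z_i\partial z_j}\frac{\partial z_k}{\partial f_l}-\frac1{n+1}\Big(\delta^k_i\frac{\partial}{\partial z_j}+\delta^k_j\frac{\partial}{\partial z_i}\Big)\log J_f,\qquad i,j,k=1,\dots,n,$$ where $\partial z_k/\partial f_l$ is the $(k,l)$ entry of $(Df)^{-1}$. The Schwarzian operator is $S_f(z)(\vec v)=(\vec v^{\,t}S^1_f(z)\vec v,\dots,\vec v^{\,t}S^n_f(z)\vec v)$, where $S^k_f=(S^k_{ij}f)_{i,j}$. The Bergman norm (of $\mathbb P^n$) of a vector $\vec v$ at $z\in\mathbb P^n$ is $\|\vec v\|=\big[2\sum_i|v_i|^2/(1-|z_i|^2)^2\big]^{1/2}$, and $\|S_f(z)\|=\sup_{\|\vec v\|=1}\|S_f(z)(\vec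 v)\|$. For $0<r<1$, $\mathcal F_{\alpha,r}$ is the set of mappings $f:\{|z|_\infty<r\}\to\mathbb C^n$ that are locally biholomorphic, with $f(0)=0$, $Df(0)=I$, and $\sup_{|z|_\infty<r}\|S_f(z)\|\le\alpha$, the norm being the Bergman norm of the full polydisk $\mathbb P^n$ restricted to $|z|_\infty<r$. The supremum $\mu_r(\alpha)$ is finite and attained. *)

theory Defs
  imports "HOL-Analysis.Analysis"
begin

text \<open>Points of complex n-space are vectors of type \<^typ>\<open>complex ^ 'n\<close>, with n = \<^term>\<open>CARD('n)\<close>.
  Maps defined only on an open set are modelled by total functions; everything below depends on
  their values in that open set only.\<close>

definition polydisk :: "real \<Rightarrow> (complex ^ 'n) set" where
  "polydisk r = {z. \<forall>i. norm (z $ i) < r}"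

text \<open>Frechet differentiability with a complex-linear derivative.\<close>

definition holomorphic_map_on :: "(complex ^ 'n \<Rightarrow> complex ^ 'n) \<Rightarrow> (complex ^ 'n) set \<Rightarrow> bool" where
  "holomorphic_map_on f S \<longleftrightarrow>
     (\<forall>z\<in>S. \<exists>A :: complex ^ 'n ^ 'n. (f has_derivative (\<lambda>h. A *v h)) (at z))"

definition locally_biholomorphic_on :: "(complex ^ 'n \<Rightarrow> complex ^ 'n) \<Rightarrow> (complex ^ 'n) set \<Rightarrow> bool" where
  "locally_biholomorphic_on f S \<longleftrightarrow>
     (\<forall>z\<in>S. \<exists>U. open U \<and> z \<in> U \<and> U \<subseteq> S \<and> holomorphic_map_on f U \<and> open (f ` U) \<and>
        (\<exists>g. holomorphic_map_on g (f ` U) \<and> (\<forall>w\<in>U. g (f w) = w)))"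

definition pderiv_at :: "'n \<Rightarrow> (complex ^ 'n \<Rightarrow> complex) \<Rightarrow> complex ^ 'n \<Rightarrow> complex" where
  "pderiv_at i g z = deriv (\<lambda>t. g (z + axis i t)) 0"

definition jacobian_mat :: "(complex ^ 'n \<Rightarrow> complex ^ 'n) \<Rightarrow> complex ^ 'n \<Rightarrow> complex ^ 'n ^ 'n" where
  "jacobian_mat f z = (\<chi> l j. pderiv_at j (\<lambda>w. f w $ l) z)"

definition jacobian_det :: "(complex ^ 'n \<Rightarrow> complex ^ 'n) \<Rightarrow> complex ^ 'n \<Rightarrow> complex" where
  "jacobian_det f z = det (jacobian_mat f z)"

definition gradient :: "(complex ^ 'n \<Rightarrow> complex) \<Rightarrow> complex ^ 'n \<Rightarrow> complex ^ 'n" where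
  "gradient g z = (\<chi> i. pderiv_at i g z)"

text \<open>The partial derivative of any local branch of log g at a point where g does not vanish; the
  principal branch \<^const>\<open>Ln\<close> would be discontinuous along its cut.\<close>

definition log_pderiv_at :: "'n \<Rightarrow> (complex ^ 'n \<Rightarrow> complex) \<Rightarrow> complex ^ 'n \<Rightarrow> complex" where
  "log_pderiv_at i g z = pderiv_at i g z / g z"

definition schwarzian :: "'n \<Rightarrow> 'n \<Rightarrow> 'n \<Rightarrow> (complex ^ 'n \<Rightarrow> complex ^ 'n) \<Rightarrow> complex ^ 'n \<Rightarrow> complex" where
  "schwarzian k i j f z =
     (\<Sum>l\<in>UNIV. pderiv_at i (pderiv_at j (\<lambda>w. f w $ l)) z * matrix_inv (jacobian_mat f z) $ k $ l)
     - 1 / (of_nat CARD('n) + 1) *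
       ((if k = i then 1 else 0) * log_pderiv_at j (jacobian_det f) z
        + (if k = j then 1 else 0) * log_pderiv_at i (jacobian_det f) z)"

definition schwarzian_op :: "(complex ^ 'n \<Rightarrow> complex ^ 'n) \<Rightarrow> complex ^ 'n \<Rightarrow> complex ^ 'n \<Rightarrow> complex ^ 'n" where
  "schwarzian_op f z v = (\<chi> k. \<Sum>i\<in>UNIV. \<Sum>j\<in>UNIV. v $ i * schwarzian k i j f z * v $ j)"

definition bergman_norm :: "complex ^ 'n \<Rightarrow> complex ^ 'n \<Rightarrow> real" where
  "bergman_norm z v = sqrt (2 * (\<Sum>i\<in>UNIV. (norm (v $ i))\<^sup>2 / (1 - (norm (z $ i))\<^sup>2)\<^sup>2))"

definition schwarzian_norm :: "(complex ^ 'n \<Rightarrow> complex ^ 'n) \<Rightarrow> complex ^ 'n \<Rightarrow> real" where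
  "schwarzian_norm f z = (SUP v\<in>{v. bergman_norm z v = 1}. bergman_norm z (schwarzian_op f z v))"

definition schwarzian_family :: "real \<Rightarrow> real \<Rightarrow> (complex ^ 'n \<Rightarrow> complex ^ 'n) set" where
  "schwarzian_family \<alpha> r =
     {f. locally_biholomorphic_on f (polydisk r) \<and> f 0 = 0 \<and> jacobian_mat f 0 = mat 1 \<and>
         (SUP z\<in>polydisk r. ereal (schwarzian_norm f z)) \<le> ereal \<alpha>}"

text \<open>The type argument carries the dimension. The supremum is taken in the extended reals; it is
  known to be finite for every 0 < r < 1 and positive \<open>\<alpha>\<close>, so that the conversion to a
  real number does not change its value.\<close>

definition mu :: "'n::finite itself \<Rightarrow> real \<Rightarrow> real \<Rightarrow> real" where
  "mu N r \<alpha> = real_of_ereal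
     (SUP f\<in>(schwarzian_family \<alpha> r :: (complex ^ 'n \<Rightarrow> complex ^ 'n) set).
        ereal (norm (gradient (jacobian_det f) 0)))"

end

theory Submission
  imports Defs "HOL-Complex_Analysis.Cauchy_Integral_Formula"
begin

text \<open>The dilation $f_\rho(z) = f(\rho z)/\rho$ multiplies both $\nabla J_f(0)$ and the Schwarzian
  coefficients by $\rho$. Comparing Bergman norms at $z$ and $\rho z$ shows that it maps the family of
  level $\alpha$ into the family of level $\alpha\rho(1-\rho^2r^2)/(1-r^2) \le \alpha\rho^{1/C}$,
  where $C = C(r)$. Hence $\mu_r(t\alpha) \ge t^C\mu_r(\alpha)$ for $0 < t \le 1$: the function
  $\alpha^{-C}\mu_r(\alpha)$ is nonincreasing while $\mu_r$ is nondecreasing, and both claims follow.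
  The same inequality makes the supremum infinite either for all $\alpha$ or for none; in the former
  case its conversion to a real number is identically zero.\<close>

section \<open>Holomorphic dependence of a derivative on a parameter\<close>

text \<open>By Cauchy estimates the difference quotients in the second argument converge uniformly in the
  first one.\<close>

lemma holomorphic_on_deriv_second_argument:
  fixes F :: "complex \<Rightarrow> complex \<Rightarrow> complex"
  assumes "0 < d"
    and hol1: "\<And>s. s \<in> ball 0 d \<Longrightarrow> (\<lambda>t. F t s) holomorphic_on ball 0 d"
    and hol2: "\<And>t. t \<in> ball 0 d \<Longrightarrow> F t holomorphic_on ball 0 d"
    and bounded: "\<And>s t. s \<in> ball 0 d \<Longrightarrow> t \<in> ball 0 d \<Longrightarrow> norm (F t s) < B"
  shows "(\<lambda>t. deriv (F t) 0) holomorphic_on ball 0 d"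
proof -
  \<comment> \<open>Cauchy's bound for the second derivative on discs of radius
    \<open>d / 2\<close>: around points of \<open>ball 0 (d / 2)\<close> they stay in
    \<open>ball 0 d\<close>, where \<open>B\<close> bounds \<open>F\<close>.\<close>
  define C where "C = fact 2 * B / (d / 2)\<^sup>2"
  have taylor: "norm (F t s - (F t 0 + deriv (F t) 0 * s)) \<le> C * (norm s)\<^sup>2"
    if t: "t \<in> ball 0 d" and s: "s \<in> ball 0 (d / 2)" for s t
  proof -
    have holn: "(deriv ^^ k) (F t) holomorphic_on ball 0 d" for k
      by (intro holomorphic_higher_deriv hol2 t) auto
    have "((deriv ^^ k) (F t) has_field_derivative (deriv ^^ Suc k) (F t) x) (at x within ball 0 (d / 2))"
      if "x \<in> ball 0 (d / 2)" for k x
    proof -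
      have "x \<in> ball 0 d" using that \<open>0 < d\<close> by auto
      then show ?thesis
        using holomorphic_derivI[OF holn[of k] open_ball] by (auto intro: has_field_derivative_at_within)
    qed
    moreover have "norm ((deriv ^^ Suc 1) (F t) x) \<le> C" if x: "x \<in> ball 0 (d / 2)" for x
    proof -
      have sub: "cball x (d / 2) \<subseteq> ball 0 d"
      proof
        fix y assume "y \<in> cball x (d / 2)"
        then have "norm (y - x) \<le> d / 2" by (simp add: dist_norm norm_minus_commute)
        then show "y \<in> ball 0 d" using x norm_triangle_ineq[of "y - x" x] by simp
      qed
      have "norm ((deriv ^^ 2) (F t) x) \<le> fact 2 * B / (d / 2) ^ 2"
      proof (rule Cauchy_higher_deriv_bound[where y = 0])
        show "F t holomorphic_on ball x (d / 2)"
          using hol2[OF t] holomorphic_on_subset sub ball_subset_cball by blast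
        show "continuous_on (cball x (d / 2)) (F t)"
          using hol2[OF t] holomorphic_on_imp_continuous_on continuous_on_subset sub by blast
        show "F t w \<in> ball 0 B" if "w \<in> ball x (d / 2)" for w
          using bounded[OF _ t, of w] that sub ball_subset_cball by force
      qed (use \<open>0 < d\<close> in auto)
      then show ?thesis by (simp add: C_def numeral_2_eq_2)
    qed
    ultimately have "norm ((deriv ^^ 0) (F t) s - (\<Sum>i\<le>1. (deriv ^^ i) (F t) 0 * (s - 0) ^ i / fact i))
        \<le> C * norm (s - 0) ^ Suc 1 / fact 1"
      using \<open>0 < d\<close> by (intro complex_Taylor[of "ball 0 (d / 2)"] s) auto
    then show ?thesis by (simp add: power2_eq_square)
  qed
  have "C \<ge> 0"
    using bounded[of 0 0] \<open>0 < d\<close> norm_ge_zero[of "F 0 0"] by (simp add: C_def del: norm_ge_zero)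
  \<comment> \<open>The shift by two makes \<open>q n < d / 2\<close> strict already at
    \<open>n = 0\<close>, so the Taylor bound applies to every increment \<open>h n\<close>.\<close>
  define q where "q n = d / 2 * inverse (real (Suc (Suc n)))" for n
  have q: "0 < q n" "q n < d / 2" "q n < d" for n
    using \<open>0 < d\<close> by (auto simp: q_def field_simps intro!: add_pos_nonneg)
  have q_lim: "q \<longlonglongrightarrow> d / 2 * 0"
    unfolding q_def by (rule tendsto_mult[OF tendsto_const LIMSEQ_Suc[OF LIMSEQ_inverse_real_of_nat]])
  define h where "h n = complex_of_real (q n)" for n
  have h: "h n \<noteq> 0" "h n \<in> ball 0 (d / 2)" "h n \<in> ball 0 d" "norm (h n) = q n" for n
    using q[of n] by (auto simp: h_def)
  show ?thesis
  \<comment> \<open>Locally uniform limits of holomorphic functions are holomorphic; the Taylor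
    bound leaves the error \<open>C * q n\<close>, the same for all \<open>t\<close>.\<close>
  proof (rule holomorphic_uniform_sequence)
    show "(\<lambda>t. (F t (h n) - F t 0) / h n) holomorphic_on ball 0 d" for n
      using h[of n] \<open>0 < d\<close> by (intro holomorphic_intros hol1) auto
    show "\<exists>e>0. cball x e \<subseteq> ball 0 d \<and>
        uniform_limit (cball x e) (\<lambda>n t. (F t (h n) - F t 0) / h n) (\<lambda>t. deriv (F t) 0) sequentially"
      if x: "x \<in> ball 0 d" for x
    proof -
      obtain e where e: "e > 0" "cball x e \<subseteq> ball 0 d"
        using open_contains_cball_eq[OF open_ball] x by metis
      have lim: "(\<lambda>n. C * q n) \<longlonglongrightarrow> 0"
        using tendsto_mult_left[OF q_lim, of C] by simp
      have "uniform_limit (cball x e) (\<lambda>n t. (F t (h n) - F t 0) / h n) (\<lambda>t. deriv (F t) 0) sequentially"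
        unfolding uniform_limit_iff
      proof (intro allI impI)
        fix \<epsilon> :: real assume "0 < \<epsilon>"
        with lim have "\<forall>\<^sub>F n in sequentially. C * q n < \<epsilon>"
          by (rule order_tendstoD)
        then show "\<forall>\<^sub>F n in sequentially. \<forall>t\<in>cball x e. dist ((F t (h n) - F t 0) / h n) (deriv (F t) 0) < \<epsilon>"
        proof (rule eventually_mono, intro ballI)
          fix n t assume less: "C * q n < \<epsilon>" and "t \<in> cball x e"
          then have "t \<in> ball 0 d" using e by blast
          have "(F t (h n) - F t 0) / h n - deriv (F t) 0 = (F t (h n) - (F t 0 + deriv (F t) 0 * h n)) / h n"
            using h(1)[of n] by (simp add: field_simps)
          then have "dist ((F t (h n) - F t 0) / h n) (deriv (F t) 0) =
              norm (F t (h n) - (F t 0 + deriv (F t) 0 * h n)) / norm (h n)"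
            by (simp add: dist_norm norm_divide)
          also have "\<dots> \<le> C * (norm (h n))\<^sup>2 / norm (h n)"
            using taylor[OF \<open>t \<in> ball 0 d\<close> h(2)] by (rule divide_right_mono) simp
          also have "\<dots> = C * q n"
            unfolding power2_eq_square using h(1,4)[of n] by simp
          finally show "dist ((F t (h n) - F t 0) / h n) (deriv (F t) 0) < \<epsilon>" using less by simp
        qed
      qed
      with e show ?thesis by blast
    qed
  qed auto
qed

section \<open>Holomorphy along complex coordinate lines\<close>

lemma axis_add: "axis i (a + b) = axis i a + (axis i b :: 'a::monoid_add ^ 'n)"
  by (simp add: vec_eq_iff axis_def)

lemma norm_axis: "norm (axis i t :: 'a::real_normed_vector ^ 'n) = norm t"
proof -
  have "(\<lambda>j. (norm ((axis i t :: 'a ^ 'n) $ j))\<^sup>2) = (\<lambda>j. if j = i then (norm t)\<^sup>2 else 0)"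
    by (auto simp: axis_def)
  then have "(\<Sum>j\<in>UNIV. (norm ((axis i t :: 'a ^ 'n) $ j))\<^sup>2) = (norm t)\<^sup>2"
    by (simp only:) simp
  then show ?thesis unfolding norm_vec_def L2_set_def by (simp only:) simp
qed

lemma norm_axis_add_le:
  "norm (axis i s + axis j t :: complex ^ 'n) \<le> norm s + norm t"
  using norm_triangle_ineq[of "axis i s :: complex ^ 'n" "axis j t"] by (simp add: norm_axis)

text \<open>\<open>pderiv_at\<close> sees a function only along complex coordinate lines, so
  differentiability along these lines is the regularity that its product and chain rules call
  for.\<close>

definition axis_holomorphic_on :: "(complex ^ 'n \<Rightarrow> complex) \<Rightarrow> (complex ^ 'n) set \<Rightarrow> bool" where
  "axis_holomorphic_on g S \<longleftrightarrow> (\<forall>z\<in>S. \<forall>i. (\<lambda>t. g (z + axis i t)) field_differentiable at 0)"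

text \<open>Moving the base point along the line turns differentiability at parameter 0 into
  differentiability at \<open>t\<close>.\<close>

lemma axis_holomorphic_onD:
  assumes "axis_holomorphic_on g S" "z + axis i t \<in> S"
  shows "(\<lambda>s. g (z + axis i s)) field_differentiable at t"
proof -
  have "(\<lambda>s. g (z + axis i t + axis i s)) field_differentiable at 0"
    using assms by (simp add: axis_holomorphic_on_def)
  then obtain D where "((\<lambda>s. g (z + axis i t + axis i s)) has_field_derivative D) (at 0)"
    by (auto simp: field_differentiable_def)
  then have "((\<lambda>s. g (z + axis i (t + s))) has_field_derivative D) (at 0)"
    by (simp add: axis_add add.assoc)
  then show ?thesis
    using DERIV_shift[of "\<lambda>s. g (z + axis i s)" D 0 t] by (auto simp: field_differentiable_def add.commute)
qed

text \<open>Needed because the partial derivatives are defined through \<^const>\<open>deriv\<close>, which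
  takes an unspecified value, not respecting scaling, at points of non-differentiability.\<close>

lemma axis_holomorphic_on_pderiv_at:
  fixes g :: "complex ^ 'n \<Rightarrow> complex"
  assumes "open S" and hol: "axis_holomorphic_on g S" and cont: "continuous_on S g"
  shows "axis_holomorphic_on (pderiv_at j g) S"
  unfolding axis_holomorphic_on_def
proof (intro ballI allI)
  fix z i assume "z \<in> S"
  \<comment> \<open>Continuity supplies the local bound on \<open>g\<close> that the Cauchy
    estimates use.\<close>
  have "\<forall>\<^sub>F w in nhds z. w \<in> S \<and> dist (g w) (g z) < 1"
    using \<open>open S\<close> \<open>z \<in> S\<close> cont
    by (auto intro!: eventually_conj eventually_nhds_in_open tendstoD
        simp: continuous_on_eq_continuous_at isCont_def tendsto_at_iff_tendsto_nhds)
  then obtain e where "e > 0" and e: "\<And>w. dist w z < e \<Longrightarrow> w \<in> S \<and> dist (g w) (g z) < 1"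
    by (auto simp: eventually_nhds_metric)
  \<comment> \<open>Halving leaves room for displacements in two coordinate directions at
    once.\<close>
  define d where "d = e / 2"
  have near: "z + axis i t + axis j s \<in> S \<and> dist (g (z + axis i t + axis j s)) (g z) < 1"
    if "t \<in> ball 0 d" "s \<in> ball 0 d" for s t
  proof (rule e)
    show "dist (z + axis i t + axis j s) z < e"
      using that norm_axis_add_le[of i t j s] by (simp add: dist_norm d_def add.assoc)
  qed
  have "(\<lambda>t. deriv (\<lambda>s. g (z + axis i t + axis j s)) 0) holomorphic_on ball 0 d"
  proof (rule holomorphic_on_deriv_second_argument[where B = "norm (g z) + 1"])
    show "0 < d" using \<open>e > 0\<close> by (simp add: d_def)
    fix s :: complex assume s: "s \<in> ball 0 d"
    have "(\<lambda>s'. g (z + axis i s + axis j s')) field_differentiable at t" if "t \<in> ball 0 d" for t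
      using near[OF s that] by (intro axis_holomorphic_onD[OF hol]) auto
    then show "(\<lambda>s'. g (z + axis i s + axis j s')) holomorphic_on ball 0 d"
      unfolding holomorphic_on_def using field_differentiable_at_within by metis
    have swap: "z + axis i t + axis j s = (z + axis j s) + axis i t" for t by simp
    have "(\<lambda>t. g ((z + axis j s) + axis i t)) field_differentiable at t" if "t \<in> ball 0 d" for t
      using near[OF that s] by (intro axis_holomorphic_onD[OF hol]) (simp only: swap)
    then have "(\<lambda>t. g ((z + axis j s) + axis i t)) holomorphic_on ball 0 d"
      unfolding holomorphic_on_def using field_differentiable_at_within by metis
    then show "(\<lambda>t. g (z + axis i t + axis j s)) holomorphic_on ball 0 d"
      by (simp add: algebra_simps)
    fix t :: complex assume "t \<in> ball 0 d"
    then have "dist (g (z + axis i t + axis j s)) (g z) < 1" using near s by blast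
    then show "norm (g (z + axis i t + axis j s)) < norm (g z) + 1"
      using norm_triangle_sub[of "g (z + axis i t + axis j s)" "g z"] by (simp add: dist_norm)
  qed
  then have "(\<lambda>t. pderiv_at j g (z + axis i t)) holomorphic_on ball 0 d"
    by (simp add: pderiv_at_def)
  then show "(\<lambda>t. pderiv_at j g (z + axis i t)) field_differentiable at 0"
    using \<open>e > 0\<close> by (auto intro: holomorphic_on_imp_differentiable_at[of _ "ball 0 d"] simp: d_def)
qed

text \<open>Restricted to a coordinate line, the complex-linear derivative is multiplication by the
  entry \<open>A $ l $ i\<close>, hence a complex derivative in one variable.\<close>

lemma holomorphic_map_on_component:
  fixes f :: "complex ^ 'n \<Rightarrow> complex ^ 'n"
  assumes "holomorphic_map_on f S"
  shows "axis_holomorphic_on (\<lambda>w. f w $ l) S" and "continuous_on S f"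
proof -
  show "axis_holomorphic_on (\<lambda>w. f w $ l) S"
    unfolding axis_holomorphic_on_def
  proof (intro ballI allI)
    fix z i assume "z \<in> S"
    then obtain A :: "complex ^ 'n ^ 'n" where "(f has_derivative (\<lambda>h. A *v h)) (at z)"
      using assms by (auto simp: holomorphic_map_on_def)
    then have A: "(f has_derivative (\<lambda>h. A *v h)) (at (z + axis i 0))"
      by (simp add: axis_def zero_vec_def[symmetric])
    have lin: "bounded_linear (\<lambda>t. axis i t :: complex ^ 'n)"
      by (intro bounded_linear_intro[where K = 1]) (simp_all add: axis_add norm_axis, simp add: vec_eq_iff axis_def)
    have "((\<lambda>t. z + axis i t) has_derivative (\<lambda>t. axis i t)) (at 0)"
      by (auto intro!: derivative_eq_intros bounded_linear_imp_has_derivative lin)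
    from has_derivative_compose[OF this A]
    have "((\<lambda>t. f (z + axis i t)) has_derivative (\<lambda>t. A *v axis i t)) (at 0)" .
    from bounded_linear.has_derivative[OF bounded_linear_vec_nth this, of l]
    have "((\<lambda>t. f (z + axis i t) $ l) has_derivative (\<lambda>t. (A *v axis i t) $ l)) (at 0)" .
    moreover have "(\<lambda>t. (A *v axis i t) $ l) = (*) (A $ l $ i)"
      by (auto simp: matrix_vector_mult_def axis_def if_distrib cong: if_cong)
    ultimately show "(\<lambda>t. f (z + axis i t) $ l) field_differentiable at 0"
      by (auto simp: field_differentiable_def has_field_derivative_def)
  qed
  show "continuous_on S f"
    using assms has_derivative_continuous
    by (fastforce simp: holomorphic_map_on_def intro!: continuous_at_imp_continuous_on)
qed

text \<open>The determinant is a polynomial in the first partials, so differentiability along lines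
  passes to it through sums and products. Both facts are what a further partial derivative in the
  Schwarzian requires.\<close>

lemma holomorphic_map_on_jacobian:
  fixes f :: "complex ^ 'n \<Rightarrow> complex ^ 'n"
  assumes "open S" "holomorphic_map_on f S"
  shows "axis_holomorphic_on (pderiv_at j (\<lambda>w. f w $ l)) S"
    and "axis_holomorphic_on (jacobian_det f) S"
proof -
  show *: "axis_holomorphic_on (pderiv_at j (\<lambda>w. f w $ l)) S" for j l
    using assms holomorphic_map_on_component
    by (intro axis_holomorphic_on_pderiv_at continuous_intros) auto
  have prod: "(\<lambda>t. \<Prod>x\<in>X. u x t) field_differentiable at 0"
    if "\<And>x. u x field_differentiable at 0" for u :: "'n \<Rightarrow> complex \<Rightarrow> complex" and X :: "'n set"
    using finite[of X] by (induction X) (simp_all add: that field_differentiable_mult)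
  show "axis_holomorphic_on (jacobian_det f) S"
    unfolding axis_holomorphic_on_def jacobian_det_def det_def jacobian_mat_def vec_lambda_beta
    using * by (intro ballI allI field_differentiable_sum field_differentiable_mult field_differentiable_const prod)
      (simp add: axis_holomorphic_on_def)
qed

section \<open>Polydisks and partial derivatives under scaling\<close>

lemma axis_scaleR: "axis i (c *\<^sub>R a) = c *\<^sub>R (axis i a :: 'a::real_vector ^ 'n)"
  by (simp add: vec_eq_iff axis_def)

lemma open_polydisk: "open (polydisk r :: (complex ^ 'n) set)"
proof -
  have "polydisk r = (\<Inter>i. {z :: complex ^ 'n. norm (z $ i) < r})"
    by (auto simp: polydisk_def)
  moreover have "open {z :: complex ^ 'n. norm (z $ i) < r}" for i
    by (intro open_Collect_less continuous_intros)
  ultimately show ?thesis by (auto intro: open_INT)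
qed

lemma scaleR_polydisk:
  assumes "0 < \<rho>" "\<rho> \<le> 1" "z \<in> polydisk r"
  shows "\<rho> *\<^sub>R z \<in> polydisk r"
proof -
  have "\<rho> * norm (z $ i) \<le> norm (z $ i)" for i
    using assms by (intro mult_left_le_one_le) auto
  then show ?thesis
    using assms by (auto simp: polydisk_def intro: le_less_trans)
qed

lemma locally_biholomorphic_on_imp_holomorphic:
  "locally_biholomorphic_on f S \<Longrightarrow> holomorphic_map_on f S"
  unfolding locally_biholomorphic_on_def holomorphic_map_on_def by blast

text \<open>A derivative depends only on the germ. This matters because identities for dilated maps
  hold only where the scaled point lies in the domain.\<close>

lemma pderiv_at_cong:
  fixes z :: "complex ^ 'n"
  assumes "open S" "z \<in> S" "\<And>w. w \<in> S \<Longrightarrow> g w = h w"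
  shows "pderiv_at i g z = pderiv_at i h z"
  unfolding pderiv_at_def
proof (rule deriv_cong_ev)
  have "continuous_on UNIV (\<lambda>t. z + (axis i t :: complex ^ 'n))"
    by (intro continuous_intros linear_continuous_on bounded_linear_intro[where K = 1])
      (simp_all add: axis_add axis_scaleR norm_axis)
  then have "open ((\<lambda>t. z + (axis i t :: complex ^ 'n)) -` S)"
    using \<open>open S\<close> by (rule open_vimage[rotated])
  then have "\<forall>\<^sub>F t in nhds 0. t \<in> (\<lambda>t. z + (axis i t :: complex ^ 'n)) -` S"
    using \<open>z \<in> S\<close> by (intro eventually_nhds_in_open) (auto simp: axis_def zero_vec_def[symmetric])
  then show "\<forall>\<^sub>F t in nhds 0. g (z + axis i t) = h (z + axis i t)"
    by (rule eventually_mono) (simp add: assms(3))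
qed simp

lemma pderiv_at_cmult:
  assumes "axis_holomorphic_on g S" "z \<in> S"
  shows "pderiv_at i (\<lambda>w. c * g w) z = c * pderiv_at i g z"
  using assms unfolding pderiv_at_def axis_holomorphic_on_def by (intro deriv_cmult) auto

text \<open>One-variable chain rule: scaling by \<rho> carries the coordinate line through
  \<open>z\<close> to the parallel line through \<open>\<rho> *\<^sub>R z\<close>, with parameter
  multiplied by \<rho>.\<close>

lemma pderiv_at_scaleR_arg:
  fixes g :: "complex ^ 'n \<Rightarrow> complex"
  assumes "axis_holomorphic_on g S" "\<rho> *\<^sub>R z \<in> S"
  shows "pderiv_at i (\<lambda>w. g (\<rho> *\<^sub>R w)) z = complex_of_real \<rho> * pderiv_at i g (\<rho> *\<^sub>R z)"
proof -
  have diff: "(\<lambda>t. g (\<rho> *\<^sub>R z + axis i t)) field_differentiable at 0"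
    using assms by (simp add: axis_holomorphic_on_def)
  have "((\<lambda>t. g (\<rho> *\<^sub>R z + axis i t)) has_field_derivative pderiv_at i g (\<rho> *\<^sub>R z)) (at (complex_of_real \<rho> * 0))"
    using diff by (simp add: pderiv_at_def field_differentiable_derivI)
  moreover have "((\<lambda>t. complex_of_real \<rho> * t) has_field_derivative complex_of_real \<rho>) (at 0)"
    by (auto intro!: derivative_eq_intros)
  ultimately have "((\<lambda>t. g (\<rho> *\<^sub>R z + axis i (complex_of_real \<rho> * t))) has_field_derivative
      pderiv_at i g (\<rho> *\<^sub>R z) * complex_of_real \<rho>) (at 0)"
    by (rule DERIV_chain2)
  moreover have "\<rho> *\<^sub>R z + axis i (complex_of_real \<rho> * t) = \<rho> *\<^sub>R (z + axis i t)" for t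
    by (simp add: scaleR_add_right flip: axis_scaleR scaleR_conv_of_real)
  ultimately show ?thesis
    unfolding pderiv_at_def[of i "\<lambda>w. g (\<rho> *\<^sub>R w)"] by (simp add: DERIV_imp_deriv mult.commute)
qed

section \<open>Dilations and the Schwarzian coefficients\<close>

text \<open>The division by \<rho> keeps the Jacobian matrix at the origin, and so the normalisation
  of the family.\<close>

definition dilation :: "real \<Rightarrow> (complex ^ 'n \<Rightarrow> complex ^ 'n) \<Rightarrow> complex ^ 'n \<Rightarrow> complex ^ 'n" where
  "dilation \<rho> f w = (1 / \<rho>) *\<^sub>R f (\<rho> *\<^sub>R w)"

context
  fixes f :: "complex ^ 'n \<Rightarrow> complex ^ 'n" and \<rho> :: real and S :: "(complex ^ 'n) set"
  assumes S: "open S" and hol: "holomorphic_map_on f S" and \<rho>: "0 < \<rho>"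
begin

text \<open>The inner factor \<rho> from the chain rule cancels the outer factor 1/\<rho>.\<close>

lemma pderiv_at_dilation:
  assumes "\<rho> *\<^sub>R z \<in> S"
  shows "pderiv_at j (\<lambda>w. dilation \<rho> f w $ l) z = pderiv_at j (\<lambda>w. f w $ l) (\<rho> *\<^sub>R z)"
proof -
  note * = holomorphic_map_on_component(1)[OF hol, of l]
  have **: "axis_holomorphic_on (\<lambda>w. complex_of_real (1 / \<rho>) * f w $ l) S"
    using * \<rho> unfolding axis_holomorphic_on_def
    by (auto intro!: derivative_intros)
  show ?thesis
    using pderiv_at_scaleR_arg[OF ** assms, of j] pderiv_at_cmult[OF * assms, of j "complex_of_real (1 / \<rho>)"] \<rho>
    by (simp add: dilation_def scaleR_conv_of_real[where 'a = complex])
qed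

lemma jacobian_dilation:
  assumes "\<rho> *\<^sub>R z \<in> S"
  shows "jacobian_mat (dilation \<rho> f) z = jacobian_mat f (\<rho> *\<^sub>R z)"
    and "jacobian_det (dilation \<rho> f) z = jacobian_det f (\<rho> *\<^sub>R z)"
  using pderiv_at_dilation[OF assms] by (simp_all add: jacobian_mat_def jacobian_det_def)

text \<open>Every derivative beyond the first contributes one factor \<rho>: here \<open>h\<close>
  is a first partial or the Jacobian determinant of the dilated map, known only on the preimage of
  \<open>S\<close>.\<close>

lemma pderiv_at_dilation_cong:
  assumes g: "axis_holomorphic_on g S" and z: "\<rho> *\<^sub>R z \<in> S"
    and eq: "\<And>w. \<rho> *\<^sub>R w \<in> S \<Longrightarrow> h w = g (\<rho> *\<^sub>R w)"
  shows "pderiv_at i h z = complex_of_real \<rho> * pderiv_at i g (\<rho> *\<^sub>R z)"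
proof -
  have "open ((\<lambda>w. \<rho> *\<^sub>R w) -` S)"
    using S by (intro open_vimage continuous_intros)
  then have "pderiv_at i h z = pderiv_at i (\<lambda>w. g (\<rho> *\<^sub>R w)) z"
    using z eq by (intro pderiv_at_cong) auto
  then show ?thesis
    using pderiv_at_scaleR_arg[OF g z] by simp
qed

text \<open>Each term contains exactly one derivative beyond the Jacobian matrix: second partials
  and logarithmic derivatives scale by \<rho>, while the inverse Jacobian matrix does not
  scale.\<close>

lemma schwarzian_dilation:
  assumes "\<rho> *\<^sub>R z \<in> S"
  shows "schwarzian k i j (dilation \<rho> f) z = complex_of_real \<rho> * schwarzian k i j f (\<rho> *\<^sub>R z)"
proof -
  have second: "pderiv_at i (pderiv_at j (\<lambda>w. dilation \<rho> f w $ l)) z =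
      complex_of_real \<rho> * pderiv_at i (pderiv_at j (\<lambda>w. f w $ l)) (\<rho> *\<^sub>R z)" for i l
    by (rule pderiv_at_dilation_cong[OF holomorphic_map_on_jacobian(1)[OF S hol] assms pderiv_at_dilation])
  have log: "log_pderiv_at i (jacobian_det (dilation \<rho> f)) z =
      complex_of_real \<rho> * log_pderiv_at i (jacobian_det f) (\<rho> *\<^sub>R z)" for i
    using pderiv_at_dilation_cong[OF holomorphic_map_on_jacobian(2)[OF S hol] assms jacobian_dilation(2)]
      jacobian_dilation(2)[OF assms]
    by (simp add: log_pderiv_at_def)
  show ?thesis
    unfolding schwarzian_def second log jacobian_dilation(1)[OF assms]
    by (simp add: sum_distrib_left algebra_simps)
qed

lemma schwarzian_op_dilation:
  assumes "\<rho> *\<^sub>R z \<in> S"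
  shows "schwarzian_op (dilation \<rho> f) z v = \<rho> *\<^sub>R schwarzian_op f (\<rho> *\<^sub>R z) v"
  using schwarzian_dilation[OF assms]
  by (simp add: schwarzian_op_def vec_eq_iff scaleR_conv_of_real[where 'a = complex] sum_distrib_left mult_ac)

lemma norm_gradient_dilation:
  assumes "0 \<in> S"
  shows "norm (gradient (jacobian_det (dilation \<rho> f)) 0) = \<rho> * norm (gradient (jacobian_det f) 0)"
proof -
  have "gradient (jacobian_det (dilation \<rho> f)) 0 = \<rho> *\<^sub>R gradient (jacobian_det f) 0"
    using pderiv_at_dilation_cong[OF holomorphic_map_on_jacobian(2)[OF S hol] _ jacobian_dilation(2), of 0] assms
    by (simp add: gradient_def vec_eq_iff scaleR_conv_of_real[where 'a = complex])
  then show ?thesis using \<rho> by simp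
qed

end

lemma holomorphic_map_on_subset:
  "holomorphic_map_on f S \<Longrightarrow> T \<subseteq> S \<Longrightarrow> holomorphic_map_on f T"
  by (auto simp: holomorphic_map_on_def)

lemma holomorphic_map_on_rescale:
  fixes f :: "complex ^ 'n \<Rightarrow> complex ^ 'n"
  assumes "holomorphic_map_on f S"
  shows "holomorphic_map_on (\<lambda>w. a *\<^sub>R f (b *\<^sub>R w)) ((\<lambda>w. b *\<^sub>R w) -` S)"
  unfolding holomorphic_map_on_def
proof
  fix z :: "complex ^ 'n" assume "z \<in> (\<lambda>w. b *\<^sub>R w) -` S"
  then obtain A :: "complex ^ 'n ^ 'n" where A: "(f has_derivative (\<lambda>h. A *v h)) (at (b *\<^sub>R z))"
    using assms by (auto simp: holomorphic_map_on_def)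
  have "((\<lambda>w. b *\<^sub>R w) has_derivative (\<lambda>h. b *\<^sub>R h)) (at z)"
    by (auto intro!: derivative_eq_intros)
  from has_derivative_scaleR_right[OF has_derivative_compose[OF this A], of a]
  have "((\<lambda>w. a *\<^sub>R f (b *\<^sub>R w)) has_derivative (\<lambda>h. a *\<^sub>R (A *v (b *\<^sub>R h)))) (at z)" .
  moreover have "(\<lambda>h. a *\<^sub>R (A *v (b *\<^sub>R h))) = (\<lambda>h. ((a * b) *\<^sub>R A) *v h)"
    by (auto simp: fun_eq_iff vec_eq_iff matrix_vector_mult_def scaleR_sum_right)
  ultimately show "\<exists>A. ((\<lambda>w. a *\<^sub>R f (b *\<^sub>R w)) has_derivative (\<lambda>h. A *v h)) (at z)" by metis
qed

text \<open>If \<open>g\<close> inverts \<open>f\<close> locally, then \<open>y\<close> going to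
  \<open>(1 / \<rho>) *\<^sub>R g (\<rho> *\<^sub>R y)\<close> inverts the dilation.\<close>

lemma locally_biholomorphic_on_dilation:
  fixes f :: "complex ^ 'n \<Rightarrow> complex ^ 'n"
  assumes f: "locally_biholomorphic_on f S" and "0 < \<rho>"
    and T: "open T" "(\<lambda>w. \<rho> *\<^sub>R w) ` T \<subseteq> S"
  shows "locally_biholomorphic_on (dilation \<rho> f) T"
  unfolding locally_biholomorphic_on_def
proof
  fix z assume "z \<in> T"
  then have "\<rho> *\<^sub>R z \<in> S" using T by auto
  then obtain U g where U: "open U" "\<rho> *\<^sub>R z \<in> U" "holomorphic_map_on f U" "open (f ` U)"
    and g: "holomorphic_map_on g (f ` U)" and gf: "\<And>w. w \<in> U \<Longrightarrow> g (f w) = w"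
    using f[unfolded locally_biholomorphic_on_def, THEN bspec, OF \<open>\<rho> *\<^sub>R z \<in> S\<close>]
    by (elim exE conjE) metis
  define W where "W = (\<lambda>w. \<rho> *\<^sub>R w) -` U \<inter> T"
  have "open W"
    unfolding W_def using U T by (intro open_Int open_vimage continuous_intros)
  have image: "dilation \<rho> f ` W = (\<lambda>y. \<rho> *\<^sub>R y) -` (f ` U \<inter> g -` ((\<lambda>w. (1 / \<rho>) *\<^sub>R w) -` T))" (is "_ = ?V")
  proof (intro equalityI subsetI)
    fix y assume "y \<in> dilation \<rho> f ` W"
    then show "y \<in> ?V" using gf \<open>0 < \<rho>\<close> by (auto simp: W_def dilation_def)
  next
    fix y assume "y \<in> ?V"
    then obtain u where u: "\<rho> *\<^sub>R y = f u" "u \<in> U" "(1 / \<rho>) *\<^sub>R u \<in> T" using gf by auto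
    have "dilation \<rho> f ((1 / \<rho>) *\<^sub>R u) = (1 / \<rho>) *\<^sub>R f u"
      using \<open>0 < \<rho>\<close> by (simp add: dilation_def)
    also have "\<dots> = y"
      unfolding u(1)[symmetric] using \<open>0 < \<rho>\<close> by simp
    finally have "y = dilation \<rho> f ((1 / \<rho>) *\<^sub>R u)" ..
    moreover have "(1 / \<rho>) *\<^sub>R u \<in> W" using u \<open>0 < \<rho>\<close> by (simp add: W_def)
    ultimately show "y \<in> dilation \<rho> f ` W" by blast
  qed
  have "continuous_on (f ` U) g" using g by (rule holomorphic_map_on_component)
  note continuous_open_preimage[OF this U(4)]
  moreover have "open ((\<lambda>w. (1 / \<rho>) *\<^sub>R w) -` T)"
    using T by (intro open_vimage continuous_intros)
  ultimately have "open (f ` U \<inter> g -` ((\<lambda>w. (1 / \<rho>) *\<^sub>R w) -` T))"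
    by blast
  then have "open (dilation \<rho> f ` W)"
    unfolding image by (intro open_vimage continuous_intros)
  moreover have "holomorphic_map_on (dilation \<rho> f) W"
    unfolding dilation_def[abs_def]
    using holomorphic_map_on_rescale[OF U(3)] by (rule holomorphic_map_on_subset) (auto simp: W_def)
  moreover have "holomorphic_map_on (\<lambda>y. (1 / \<rho>) *\<^sub>R g (\<rho> *\<^sub>R y)) (dilation \<rho> f ` W)"
    using holomorphic_map_on_rescale[OF g] by (rule holomorphic_map_on_subset) (auto simp: image)
  moreover have "(1 / \<rho>) *\<^sub>R g (\<rho> *\<^sub>R dilation \<rho> f w) = w" if "w \<in> W" for w
    using that gf \<open>0 < \<rho>\<close> by (simp add: dilation_def W_def)
  ultimately show "\<exists>W. open W \<and> z \<in> W \<and> W \<subseteq> T \<and> holomorphic_map_on (dilation \<rho> f) W \<and>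
      open (dilation \<rho> f ` W) \<and>
      (\<exists>h. holomorphic_map_on h (dilation \<rho> f ` W) \<and> (\<forall>w\<in>W. h (dilation \<rho> f w) = w))"
    using \<open>open W\<close> U(2) \<open>z \<in> T\<close>
    by (intro exI[of _ W] conjI exI[of _ "\<lambda>y. (1 / \<rho>) *\<^sub>R g (\<rho> *\<^sub>R y)"] ballI) (auto simp: W_def)
qed

section \<open>The Bergman norm and the supremum defining the Schwarzian norm\<close>

lemma bergman_norm_scaleR: "bergman_norm z (c *\<^sub>R v) = \<bar>c\<bar> * bergman_norm z v"
proof -
  have "2 * (\<Sum>i\<in>UNIV. (norm ((c *\<^sub>R v) $ i))\<^sup>2 / (1 - (norm (z $ i))\<^sup>2)\<^sup>2) =
      c\<^sup>2 * (2 * (\<Sum>i\<in>UNIV. (norm (v $ i))\<^sup>2 / (1 - (norm (z $ i))\<^sup>2)\<^sup>2))"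
    by (simp add: power_mult_distrib sum_distrib_left mult_ac)
  then show ?thesis
    by (simp add: bergman_norm_def real_sqrt_mult)
qed

lemma bergman_norm_nonneg: "0 \<le> bergman_norm z v"
  unfolding bergman_norm_def by (intro real_sqrt_ge_zero mult_nonneg_nonneg sum_nonneg) auto

lemma bergman_norm_mono:
  assumes "\<And>i. norm (v $ i) \<le> norm (w $ i)"
  shows "bergman_norm z v \<le> bergman_norm z w"
  unfolding bergman_norm_def
  using assms by (intro real_sqrt_le_mono mult_left_mono sum_mono divide_right_mono power_mono) auto

text \<open>The norm at a point weights coordinate i by the reciprocal of 1 - |z_i|^2, so a
  comparison of these weights with factor \<open>c\<close> in every coordinate carries over to the
  norms.\<close>

lemma bergman_norm_change_point:
  assumes "0 \<le> c" and "\<And>i. norm (z $ i) < 1" and "\<And>i. norm (w $ i) < 1"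
    and le: "\<And>i. 1 - (norm (w $ i))\<^sup>2 \<le> c * (1 - (norm (z $ i))\<^sup>2)"
  shows "bergman_norm z v \<le> c * bergman_norm w v"
proof -
  have "(norm (v $ i))\<^sup>2 / (1 - (norm (z $ i))\<^sup>2)\<^sup>2 \<le>
      c\<^sup>2 * ((norm (v $ i))\<^sup>2 / (1 - (norm (w $ i))\<^sup>2)\<^sup>2)" for i
  proof -
    have pos: "0 < 1 - (norm (z $ i))\<^sup>2" "0 < 1 - (norm (w $ i))\<^sup>2"
      using assms(2,3)[of i] by (simp_all add: power_less_one_iff abs_square_less_1)
    have "1 / (1 - (norm (z $ i))\<^sup>2) \<le> c / (1 - (norm (w $ i))\<^sup>2)"
      using pos le[of i] by (simp add: field_simps)
    then have "(1 / (1 - (norm (z $ i))\<^sup>2))\<^sup>2 \<le> (c / (1 - (norm (w $ i))\<^sup>2))\<^sup>2"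
      using pos by (intro power_mono) auto
    then have "(norm (v $ i))\<^sup>2 * (1 / (1 - (norm (z $ i))\<^sup>2))\<^sup>2 \<le>
        (norm (v $ i))\<^sup>2 * (c / (1 - (norm (w $ i))\<^sup>2))\<^sup>2"
      by (rule mult_left_mono) simp
    then show ?thesis by (simp add: power_divide mult_ac)
  qed
  then have "2 * (\<Sum>i\<in>UNIV. (norm (v $ i))\<^sup>2 / (1 - (norm (z $ i))\<^sup>2)\<^sup>2) \<le>
      2 * (\<Sum>i\<in>UNIV. c\<^sup>2 * ((norm (v $ i))\<^sup>2 / (1 - (norm (w $ i))\<^sup>2)\<^sup>2))"
    by (intro mult_left_mono sum_mono) auto
  also have "\<dots> = c\<^sup>2 * (2 * (\<Sum>i\<in>UNIV. (norm (v $ i))\<^sup>2 / (1 - (norm (w $ i))\<^sup>2)\<^sup>2))"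
    by (simp add: sum_distrib_left mult_ac)
  finally show ?thesis
    unfolding bergman_norm_def using real_sqrt_le_mono \<open>0 \<le> c\<close> by (fastforce simp: real_sqrt_mult)
qed

text \<open>All weights of the Bergman norm are at least 1 inside the unit polydisk.\<close>

lemma norm_component_le_bergman_norm:
  assumes "norm (z $ i) < 1"
  shows "norm (v $ i) \<le> bergman_norm z v"
  unfolding bergman_norm_def
proof (rule real_le_rsqrt)
  have "0 < 1 - (norm (z $ i))\<^sup>2"
    using assms by (simp add: abs_square_less_1)
  then have "(1 - (norm (z $ i))\<^sup>2)\<^sup>2 \<le> 1"
    by (intro power_le_one) auto
  then have "(norm (v $ i))\<^sup>2 \<le> (norm (v $ i))\<^sup>2 / (1 - (norm (z $ i))\<^sup>2)\<^sup>2"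
    using \<open>0 < 1 - (norm (z $ i))\<^sup>2\<close> by (simp add: pos_le_divide_eq mult_left_le)
  also have "\<dots> \<le> (\<Sum>i\<in>UNIV. (norm (v $ i))\<^sup>2 / (1 - (norm (z $ i))\<^sup>2)\<^sup>2)"
    by (rule member_le_sum) auto
  also have "\<dots> \<le> 2 * (\<Sum>i\<in>UNIV. (norm (v $ i))\<^sup>2 / (1 - (norm (z $ i))\<^sup>2)\<^sup>2)"
    by (simp add: sum_nonneg)
  finally show "(norm (v $ i))\<^sup>2 \<le> 2 * (\<Sum>i\<in>UNIV. (norm (v $ i))\<^sup>2 / (1 - (norm (z $ i))\<^sup>2)\<^sup>2)" .
qed

lemma schwarzian_op_scaleR: "schwarzian_op f z (c *\<^sub>R v) = c\<^sup>2 *\<^sub>R schwarzian_op f z v"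
  by (simp add: schwarzian_op_def vec_eq_iff scaleR_conv_of_real[where 'a = complex] sum_distrib_left power2_eq_square mult_ac)

text \<open>The supremum in \<open>schwarzian_norm\<close> thus ranges over a nonempty set, as
  \<open>cSUP_least\<close> requires.\<close>

lemma ex_bergman_norm_eq_1:
  fixes z :: "complex ^ 'n"
  assumes "\<And>i. norm (z $ i) < 1"
  shows "\<exists>v. bergman_norm z v = 1"
proof -
  fix i :: 'n
  have "0 < bergman_norm z (axis i 1)"
    using norm_component_le_bergman_norm[OF assms, of "axis i 1" i] by (simp add: axis_def)
  then have "bergman_norm z ((1 / bergman_norm z (axis i 1)) *\<^sub>R axis i 1) = 1"
    by (simp add: bergman_norm_scaleR)
  then show ?thesis ..
qed

text \<open>A real supremum is an upper bound only for bounded sets. The components of a Bergman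
  unit vector have modulus at most 1, so sums of the coefficient norms give a crude bound.\<close>

lemma bdd_above_schwarzian_op:
  fixes z :: "complex ^ 'n"
  assumes z: "\<And>i. norm (z $ i) < 1"
  shows "bdd_above ((\<lambda>v. bergman_norm z (schwarzian_op f z v)) ` {v. bergman_norm z v = 1})"
proof (rule bdd_aboveI2)
  fix v assume "v \<in> {v. bergman_norm z v = 1}"
  then have v: "norm (v $ i) \<le> 1" for i
    using norm_component_le_bergman_norm[OF z, of v i] by simp
  show "bergman_norm z (schwarzian_op f z v) \<le>
      bergman_norm z (\<chi> k. complex_of_real (\<Sum>i\<in>UNIV. \<Sum>j\<in>UNIV. norm (schwarzian k i j f z)))"
  proof (rule bergman_norm_mono)
    fix k
    have "norm (v $ i * schwarzian k i j f z * v $ j) \<le> 1 * norm (schwarzian k i j f z) * 1" for i j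
      unfolding norm_mult using v by (intro mult_mono) auto
    then have "norm (schwarzian_op f z v $ k) \<le> (\<Sum>i\<in>UNIV. \<Sum>j\<in>UNIV. norm (schwarzian k i j f z))"
      by (simp add: schwarzian_op_def sum_norm_le)
    then show "norm (schwarzian_op f z v $ k) \<le>
        norm ((\<chi> k. complex_of_real (\<Sum>i\<in>UNIV. \<Sum>j\<in>UNIV. norm (schwarzian k i j f z))) $ k)"
      using abs_ge_self by (simp only: vec_lambda_beta norm_of_real)
  qed
qed

text \<open>Quadratic homogeneity carries the bound from unit vectors to all vectors; the zero
  vector cannot be normalised and is treated apart.\<close>

lemma bergman_norm_schwarzian_op_le:
  fixes z :: "complex ^ 'n"
  assumes z: "\<And>i. norm (z $ i) < 1"
  shows "bergman_norm z (schwarzian_op f z v) \<le> schwarzian_norm f z * (bergman_norm z v)\<^sup>2"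
proof (cases "bergman_norm z v = 0")
  case True
  then have "v = 0 *\<^sub>R v"
    using norm_component_le_bergman_norm[OF z, of v] by (simp add: vec_eq_iff)
  then have "schwarzian_op f z v = 0 *\<^sub>R schwarzian_op f z v"
    using schwarzian_op_scaleR[of f z 0 v] by simp
  then have "bergman_norm z (schwarzian_op f z v) = 0"
    using bergman_norm_scaleR[of z 0 "schwarzian_op f z v"] by simp
  with True show ?thesis by simp
next
  case False
  define b where "b = bergman_norm z v"
  define u where "u = (1 / b) *\<^sub>R v"
  have "b \<noteq> 0" "0 \<le> b" using False bergman_norm_nonneg by (auto simp: b_def)
  then have v: "v = b *\<^sub>R u" and "bergman_norm z u = 1"
    by (simp_all add: u_def bergman_norm_scaleR flip: b_def)
  then have "bergman_norm z (schwarzian_op f z u) \<le> schwarzian_norm f z"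
    unfolding schwarzian_norm_def by (intro cSUP_upper bdd_above_schwarzian_op z) simp
  then have "b\<^sup>2 * bergman_norm z (schwarzian_op f z u) \<le> b\<^sup>2 * schwarzian_norm f z"
    by (rule mult_left_mono) simp
  then show ?thesis
    unfolding b_def[symmetric] by (simp add: v schwarzian_op_scaleR bergman_norm_scaleR mult_ac)
qed

section \<open>The Schwarzian family under dilation\<close>

text \<open>The coefficients give the factor \<rho>, and moving the outer norm from \<rho>z to z
  costs the fraction. The argument \<open>v\<close> costs nothing, since its norm at \<rho>z is at
  most its norm at z.\<close>

lemma schwarzian_norm_dilation_le:
  fixes f :: "complex ^ 'n \<Rightarrow> complex ^ 'n"
  assumes hol: "holomorphic_map_on f (polydisk r)" and \<rho>: "0 < \<rho>" "\<rho> \<le> 1" and r: "r < 1"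
    and z: "z \<in> polydisk r" and bound: "schwarzian_norm f (\<rho> *\<^sub>R z) \<le> \<alpha>" and "0 \<le> \<alpha>"
  shows "schwarzian_norm (dilation \<rho> f) z \<le> \<rho> * ((1 - \<rho>\<^sup>2 * r\<^sup>2) / (1 - r\<^sup>2)) * \<alpha>"
  unfolding schwarzian_norm_def
proof (rule cSUP_least)
  have \<rho>z: "\<rho> *\<^sub>R z \<in> polydisk r"
    using \<rho> z by (rule scaleR_polydisk)
  have lt1: "norm (z $ i) < 1" "norm ((\<rho> *\<^sub>R z) $ i) < 1" for i
    using z \<rho>z r by (auto simp: polydisk_def intro: less_trans)
  show "{v. bergman_norm z v = 1} \<noteq> {}"
    using ex_bergman_norm_eq_1 lt1 by auto
  fix v assume v: "v \<in> {v. bergman_norm z v = 1}"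
  \<comment> \<open>The ratio of 1 - \<rho>^2 x to 1 - x is nondecreasing in x = |z_i|^2, so its
    value at x = r^2 serves the whole polydisk.\<close>
  define c where "c = (1 - \<rho>\<^sup>2 * r\<^sup>2) / (1 - r\<^sup>2)"
  have "0 \<le> r" using z norm_ge_zero order.trans less_imp_le unfolding polydisk_def by blast
  then have r2: "r\<^sup>2 < 1" using r by (simp add: abs_square_less_1)
  have \<rho>2: "\<rho>\<^sup>2 \<le> 1" using \<rho> by (simp add: power_le_one)
  have "\<rho>\<^sup>2 * r\<^sup>2 \<le> 1 * 1" using r2 \<rho>2 by (intro mult_mono) auto
  then have "0 \<le> c" using r2 by (simp add: c_def)
  have "bergman_norm z (schwarzian_op (dilation \<rho> f) z v) = \<rho> * bergman_norm z (schwarzian_op f (\<rho> *\<^sub>R z) v)"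
    using \<rho> schwarzian_op_dilation[OF open_polydisk hol \<rho>(1) \<rho>z] by (simp add: bergman_norm_scaleR)
  moreover have "bergman_norm z (schwarzian_op f (\<rho> *\<^sub>R z) v) \<le> c * bergman_norm (\<rho> *\<^sub>R z) (schwarzian_op f (\<rho> *\<^sub>R z) v)"
  proof (rule bergman_norm_change_point)
    fix i
    define x where "x = (norm (z $ i))\<^sup>2"
    have "norm (z $ i) \<le> r" using z by (auto simp: polydisk_def less_imp_le)
    then have "x \<le> r\<^sup>2" by (simp add: x_def power_mono)
    \<comment> \<open>This product is the difference of the two sides of the next
      inequality.\<close>
    then have "0 \<le> (r\<^sup>2 - x) * (1 - \<rho>\<^sup>2)" using \<rho>2 by simp
    then have "(1 - \<rho>\<^sup>2 * x) * (1 - r\<^sup>2) \<le> (1 - \<rho>\<^sup>2 * r\<^sup>2) * (1 - x)"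
      by (simp add: algebra_simps)
    then have "1 - \<rho>\<^sup>2 * x \<le> c * (1 - x)"
      using r2 by (simp add: c_def pos_le_divide_eq)
    then show "1 - (norm ((\<rho> *\<^sub>R z) $ i))\<^sup>2 \<le> c * (1 - (norm (z $ i))\<^sup>2)"
      by (simp add: x_def power_mult_distrib)
  qed (use lt1 \<open>0 \<le> c\<close> in auto)
  moreover have "bergman_norm (\<rho> *\<^sub>R z) (schwarzian_op f (\<rho> *\<^sub>R z) v) \<le> \<alpha>"
  proof -
    have "bergman_norm (\<rho> *\<^sub>R z) v \<le> 1 * bergman_norm z v"
    proof (rule bergman_norm_change_point)
      fix i
      have "\<rho>\<^sup>2 * (norm (z $ i))\<^sup>2 \<le> 1 * (norm (z $ i))\<^sup>2"
        using \<rho>2 by (rule mult_right_mono) simp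
      then show "1 - (norm (z $ i))\<^sup>2 \<le> 1 * (1 - (norm ((\<rho> *\<^sub>R z) $ i))\<^sup>2)"
        by (simp add: power_mult_distrib)
    qed (use lt1 in auto)
    then have "(bergman_norm (\<rho> *\<^sub>R z) v)\<^sup>2 \<le> 1\<^sup>2"
      using v bergman_norm_nonneg by (intro power_mono) auto
    then have "schwarzian_norm f (\<rho> *\<^sub>R z) * (bergman_norm (\<rho> *\<^sub>R z) v)\<^sup>2 \<le> \<alpha> * 1\<^sup>2"
      using bound \<open>0 \<le> \<alpha>\<close> by (intro mult_mono) auto
    moreover have "bergman_norm (\<rho> *\<^sub>R z) (schwarzian_op f (\<rho> *\<^sub>R z) v) \<le>
        schwarzian_norm f (\<rho> *\<^sub>R z) * (bergman_norm (\<rho> *\<^sub>R z) v)\<^sup>2"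
      by (intro bergman_norm_schwarzian_op_le lt1)
    ultimately show ?thesis by simp
  qed
  then have "c * bergman_norm (\<rho> *\<^sub>R z) (schwarzian_op f (\<rho> *\<^sub>R z) v) \<le> c * \<alpha>"
    using \<open>0 \<le> c\<close> by (rule mult_left_mono)
  ultimately have "bergman_norm z (schwarzian_op (dilation \<rho> f) z v) \<le> \<rho> * (c * \<alpha>)"
    using \<rho> by simp
  then show "bergman_norm z (schwarzian_op (dilation \<rho> f) z v) \<le> \<rho> * ((1 - \<rho>\<^sup>2 * r\<^sup>2) / (1 - r\<^sup>2)) * \<alpha>"
    by (simp add: c_def)
qed

lemma dilation_in_schwarzian_family:
  fixes f :: "complex ^ 'n \<Rightarrow> complex ^ 'n"
  assumes f: "f \<in> schwarzian_family \<alpha> r" and \<rho>: "0 < \<rho>" "\<rho> \<le> 1" and r: "0 < r" "r < 1" and "0 \<le> \<alpha>"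
    and \<beta>: "\<rho> * ((1 - \<rho>\<^sup>2 * r\<^sup>2) / (1 - r\<^sup>2)) * \<alpha> \<le> \<beta>"
  shows "dilation \<rho> f \<in> schwarzian_family \<beta> r"
    and "norm (gradient (jacobian_det (dilation \<rho> f)) 0) = \<rho> * norm (gradient (jacobian_det f) 0)"
proof -
  let ?P = "polydisk r :: (complex ^ 'n) set"
  have f: "locally_biholomorphic_on f ?P" "f 0 = 0" "jacobian_mat f 0 = mat 1"
    and "(SUP z\<in>?P. ereal (schwarzian_norm f z)) \<le> ereal \<alpha>"
    using f by (auto simp: schwarzian_family_def)
  then have bound: "schwarzian_norm f z \<le> \<alpha>" if "z \<in> ?P" for z
    using that by (simp add: SUP_le_iff)
  have hol: "holomorphic_map_on f ?P"
    using f(1) by (rule locally_biholomorphic_on_imp_holomorphic)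
  have 0: "0 \<in> ?P" using r by (simp add: polydisk_def)
  have "locally_biholomorphic_on (dilation \<rho> f) ?P"
    using f(1) \<rho> open_polydisk scaleR_polydisk by (intro locally_biholomorphic_on_dilation) blast+
  moreover have "jacobian_mat (dilation \<rho> f) 0 = mat 1"
    using jacobian_dilation(1)[OF open_polydisk hol \<rho>(1), of 0] 0 f(3) by simp
  moreover have "schwarzian_norm (dilation \<rho> f) z \<le> \<beta>" if "z \<in> ?P" for z
    using schwarzian_norm_dilation_le[OF hol \<rho> r(2) that bound[OF scaleR_polydisk[OF \<rho> that]] \<open>0 \<le> \<alpha>\<close>] \<beta>
    by simp
  ultimately show "dilation \<rho> f \<in> schwarzian_family \<beta> r"
    by (auto simp: schwarzian_family_def dilation_def f(2) intro: SUP_least)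
  show "norm (gradient (jacobian_det (dilation \<rho> f)) 0) = \<rho> * norm (gradient (jacobian_det f) 0)"
    using open_polydisk hol \<rho>(1) 0 by (rule norm_gradient_dilation)
qed

section \<open>The growth inequality\<close>

text \<open>Take logarithms and use ln y \<le> y - 1 twice, for the fraction and for \<rho>^2. The
  exponent 1 - 2x/(1 - x) is the logarithmic derivative of the left side at \<rho> = 1.\<close>

lemma dilation_factor_le_powr:
  fixes \<rho> x :: real
  assumes "0 < \<rho>" "\<rho> \<le> 1" "0 \<le> x" "x < 1"
  shows "\<rho> * ((1 - \<rho>\<^sup>2 * x) / (1 - x)) \<le> \<rho> powr ((1 - 3 * x) / (1 - x))"
proof -
  have "\<rho>\<^sup>2 * x \<le> 1 * x"
    using assms by (intro mult_right_mono power_le_one) auto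
  then have pos: "0 < (1 - \<rho>\<^sup>2 * x) / (1 - x)" using assms by simp
  have "ln ((1 - \<rho>\<^sup>2 * x) / (1 - x)) \<le> (1 - \<rho>\<^sup>2 * x) / (1 - x) - 1"
    using pos by (rule ln_le_minus_one)
  also have "\<dots> = x / (1 - x) * (1 - \<rho>\<^sup>2)"
    using assms by (simp add: field_simps)
  also have "\<dots> \<le> x / (1 - x) * (- (2 * ln \<rho>))"
  proof (rule mult_left_mono)
    have "ln (\<rho>\<^sup>2) \<le> \<rho>\<^sup>2 - 1" using assms by (intro ln_le_minus_one) simp
    then show "1 - \<rho>\<^sup>2 \<le> - (2 * ln \<rho>)" using assms by (simp add: ln_realpow)
  qed (use assms in simp)
  finally have "ln (\<rho> * ((1 - \<rho>\<^sup>2 * x) / (1 - x))) \<le> ln \<rho> + x / (1 - x) * (- (2 * ln \<rho>))"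
    using pos \<open>0 < \<rho>\<close> by (subst ln_mult_pos) auto
  also have "\<dots> = (1 - 3 * x) / (1 - x) * ln \<rho>"
    using assms by (simp add: field_simps)
  finally have ln_le: "ln (\<rho> * ((1 - \<rho>\<^sup>2 * x) / (1 - x))) \<le> (1 - 3 * x) / (1 - x) * ln \<rho>" .
  have "\<rho> * ((1 - \<rho>\<^sup>2 * x) / (1 - x)) = exp (ln (\<rho> * ((1 - \<rho>\<^sup>2 * x) / (1 - x))))"
    using pos \<open>0 < \<rho>\<close> by (intro exp_ln[symmetric] mult_pos_pos)
  also have "\<dots> \<le> exp ((1 - 3 * x) / (1 - x) * ln \<rho>)"
    using ln_le by (rule iffD2[OF exp_le_cancel_iff])
  also have "\<dots> = \<rho> powr ((1 - 3 * x) / (1 - x))"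
    using \<open>0 < \<rho>\<close> by (simp add: powr_def)
  finally show ?thesis .
qed

lemma schwarzian_family_mono: "\<alpha> \<le> \<beta> \<Longrightarrow> schwarzian_family \<alpha> r \<subseteq> schwarzian_family \<beta> r"
  by (auto simp: schwarzian_family_def elim: order_trans)

text \<open>Dilating a map of level \<open>b\<close> by (a/b)^C brings it to level \<open>a\<close>,
  and its gradient shrinks by that same factor. The families are nested, which gives
  monotonicity.\<close>

lemma mu_mono_and_growth:
  fixes r :: real
  assumes r: "0 < r" "r\<^sup>2 < 1 / 3" and ab: "0 < a" "a \<le> b" and C: "(1 - r\<^sup>2) / (1 - 3 * r\<^sup>2) \<le> C"
  shows "mu TYPE('n::finite) r a \<le> mu TYPE('n) r b"
    and "(a / b) powr C * mu TYPE('n) r b \<le> mu TYPE('n) r a"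
proof -
  let ?F = "\<lambda>\<alpha>. schwarzian_family \<alpha> r :: (complex ^ 'n \<Rightarrow> complex ^ 'n) set"
  let ?N = "\<lambda>f :: complex ^ 'n \<Rightarrow> complex ^ 'n. norm (gradient (jacobian_det f) 0)"
  define M where "M \<alpha> = (SUP f\<in>?F \<alpha>. ereal (?N f))" for \<alpha>
  define \<rho> where "\<rho> = (a / b) powr C"
  have "r\<^sup>2 < 1\<^sup>2" using r by simp
  then have "r < 1" using power_less_imp_less_base zero_le_one by blast
  have "0 < (1 - r\<^sup>2) / (1 - 3 * r\<^sup>2)" using r by (intro divide_pos_pos) auto
  then have "0 < C" using C by linarith
  have \<rho>: "0 < \<rho>" "\<rho> \<le> 1" using ab \<open>0 < C\<close> by (auto simp: \<rho>_def powr_le1)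
  \<comment> \<open>Since a/b \<le> 1, an exponent of at least 1 makes the new level at most (a/b) b
    = a.\<close>
  have "1 \<le> C * ((1 - 3 * r\<^sup>2) / (1 - r\<^sup>2))"
    using C r by (simp add: field_simps)
  have "\<rho> * ((1 - \<rho>\<^sup>2 * r\<^sup>2) / (1 - r\<^sup>2)) \<le> \<rho> powr ((1 - 3 * r\<^sup>2) / (1 - r\<^sup>2))"
    using \<rho> r by (intro dilation_factor_le_powr) auto
  also have "\<dots> = (a / b) powr (C * ((1 - 3 * r\<^sup>2) / (1 - r\<^sup>2)))"
    by (simp add: \<rho>_def powr_powr)
  also have "\<dots> \<le> (a / b) powr 1"
    using ab \<open>1 \<le> _\<close> by (intro powr_mono') auto
  finally have "\<rho> * ((1 - \<rho>\<^sup>2 * r\<^sup>2) / (1 - r\<^sup>2)) \<le> a / b" using ab by simp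
  then have factor: "\<rho> * ((1 - \<rho>\<^sup>2 * r\<^sup>2) / (1 - r\<^sup>2)) * b \<le> a"
    using ab by (simp add: pos_le_divide_eq)
  have mono: "M a \<le> M b"
    unfolding M_def using schwarzian_family_mono[OF \<open>a \<le> b\<close>] by (rule SUP_subset_mono) simp
  \<comment> \<open>Stated in the extended reals, with 1/\<rho> on the right, so that infinite
    suprema are covered too.\<close>
  have growth: "M b \<le> ereal (1 / \<rho>) * M a"
    unfolding M_def[of b]
  proof (rule SUP_least)
    fix f assume f: "f \<in> ?F b"
    note * = dilation_in_schwarzian_family[OF f \<rho> r(1) \<open>r < 1\<close> _ factor]
    have "ereal (\<rho> * ?N f) \<le> M a"
      using * ab unfolding M_def by (intro SUP_upper2[of "dilation \<rho> f"]) auto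
    then have "ereal (1 / \<rho>) * ereal (\<rho> * ?N f) \<le> ereal (1 / \<rho>) * M a"
      using \<rho> by (intro ereal_mult_left_mono) auto
    then show "ereal (?N f) \<le> ereal (1 / \<rho>) * M a" using \<rho> by simp
  qed
  have mu: "mu TYPE('n) r \<alpha> = real_of_ereal (M \<alpha>)" for \<alpha>
    by (simp add: mu_def M_def)
  \<comment> \<open>\<open>mono\<close> and \<open>growth\<close> force \<open>M a\<close> and
    \<open>M b\<close> to be both finite or equal to the same infinity; infinite values convert to
    0.\<close>
  show "mu TYPE('n) r a \<le> mu TYPE('n) r b"
    using mono growth \<rho> unfolding mu by (cases "M a"; cases "M b") auto
  show "(a / b) powr C * mu TYPE('n) r b \<le> mu TYPE('n) r a"
    using mono growth \<rho> unfolding mu \<rho>_def[symmetric]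
    by (cases "M a"; cases "M b") (auto simp: field_simps)
qed

section \<open>Real-variable consequences of monotonicity and growth\<close>

text \<open>Growth bounds the increment m(b) - m(a) by m(b) (1 - (a/b)^C), and the bracket is at
  most C ln(b/a) \<le> C (b - a)/a.\<close>

lemma locally_lipschitz_of_growth:
  fixes m :: "real \<Rightarrow> real"
  assumes mono: "\<And>a b. 0 < a \<Longrightarrow> a \<le> b \<Longrightarrow> m a \<le> m b"
    and growth: "\<And>a b. 0 < a \<Longrightarrow> a \<le> b \<Longrightarrow> (a / b) powr C * m b \<le> m a"
    and "0 < C" "0 < \<alpha>"
  shows "\<exists>e>0. \<exists>L. L-lipschitz_on (ball \<alpha> e \<inter> {0<..}) m"
proof -
  \<comment> \<open>Comparing b/2 with b gives (1/2)^C m(b) \<le> m(b) with a factor below 1, which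
    excludes negative values.\<close>
  have nonneg: "0 \<le> m b" if "0 < b" for b
  proof -
    have "(1 / 2) powr C * m b \<le> m b"
      using growth[of "b / 2" b] mono[of "b / 2" b] that by simp
    moreover have "(1 / 2 :: real) powr C < 1"
      using \<open>0 < C\<close> powr_less_mono'[of "1 / 2" 0 C] by simp
    ultimately show ?thesis
      using mult_less_cancel_right_disj[of "(1 / 2) powr C" "m b" 1] by (auto simp: not_less mult_le_cancel_right2)
  qed
  \<comment> \<open>On the interval from \<alpha>/2 to 2\<alpha>, monotonicity gives m(b) \<le>
    m(2\<alpha>), and 1/a \<le> 2/\<alpha>.\<close>
  define L where "L = m (2 * \<alpha>) * (C * (2 / \<alpha>))"
  have "0 \<le> L" using nonneg[of "2 * \<alpha>"] \<open>0 < C\<close> \<open>0 < \<alpha>\<close> by (simp add: L_def)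
  have *: "m b - m a \<le> L * (b - a)" if "\<alpha> / 2 \<le> a" "a \<le> b" "b \<le> 2 * \<alpha>" for a b
  proof -
    have "0 < a" using that \<open>0 < \<alpha>\<close> by linarith
    have "1 - (a / b) powr C = 1 - exp (- (C * ln (b / a)))"
      using \<open>0 < a\<close> that by (simp add: powr_def ln_div algebra_simps)
    also have "\<dots> \<le> C * ln (b / a)"
      using exp_ge_add_one_self[of "- (C * ln (b / a))"] by simp
    also have "\<dots> \<le> C * (b / a - 1)"
      using \<open>0 < C\<close> \<open>0 < a\<close> that by (intro mult_left_mono ln_le_minus_one) auto
    also have "\<dots> = C * ((b - a) / a)"
      using \<open>0 < a\<close> by (simp add: field_simps)
    also have "\<dots> \<le> C * ((b - a) / (\<alpha> / 2))"
      using \<open>0 < C\<close> \<open>0 < \<alpha>\<close> that by (intro mult_left_mono divide_left_mono) auto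
    also have "\<dots> = C * (2 / \<alpha>) * (b - a)"
      by simp
    finally have "1 - (a / b) powr C \<le> C * (2 / \<alpha>) * (b - a)" .
    then have "m b * (1 - (a / b) powr C) \<le> m (2 * \<alpha>) * (C * (2 / \<alpha>) * (b - a))"
      using mono[of b "2 * \<alpha>"] nonneg[of "2 * \<alpha>"] \<open>0 < a\<close> \<open>0 < C\<close> that
      by (intro mult_mono) (auto intro!: powr_le1)
    also have "\<dots> = L * (b - a)"
      by (simp only: L_def mult.assoc)
    finally show ?thesis
      using growth[OF \<open>0 < a\<close> \<open>a \<le> b\<close>] by (simp add: algebra_simps)
  qed
  have dist_le: "dist (m x) (m y) \<le> L * dist x y" if xy: "\<alpha> / 2 \<le> x" "x \<le> y" "y \<le> 2 * \<alpha>" for x y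
    using *[OF xy] mono[of x y] xy \<open>0 < \<alpha>\<close> by (simp add: dist_real_def)
  have "L-lipschitz_on (ball \<alpha> (\<alpha> / 2) \<inter> {0<..}) m"
  proof (rule lipschitz_onI)
    fix x y assume "x \<in> ball \<alpha> (\<alpha> / 2) \<inter> {0<..}" "y \<in> ball \<alpha> (\<alpha> / 2) \<inter> {0<..}"
    then have "\<bar>\<alpha> - x\<bar> < \<alpha> / 2" "\<bar>\<alpha> - y\<bar> < \<alpha> / 2" by (simp_all add: dist_real_def)
    then have "\<alpha> / 2 \<le> x" "x \<le> 2 * \<alpha>" "\<alpha> / 2 \<le> y" "y \<le> 2 * \<alpha>" by linarith+
    then show "dist (m x) (m y) \<le> L * dist x y"
      using dist_le[of x y] dist_le[of y x] by (cases "x \<le> y") (auto simp: dist_commute)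
  qed fact
  then show ?thesis using \<open>0 < \<alpha>\<close> by (intro exI[of _ "\<alpha> / 2"]) auto
qed

text \<open>Growth says that m(x) x^(-C) is nonincreasing, so its derivative at \<alpha> cannot be
  positive.\<close>

lemma deriv_le_of_growth:
  fixes m :: "real \<Rightarrow> real"
  assumes growth: "\<And>a b. 0 < a \<Longrightarrow> a \<le> b \<Longrightarrow> (a / b) powr C * m b \<le> m a"
    and "0 < \<alpha>" and D: "(m has_real_derivative D) (at \<alpha>)"
  shows "\<alpha> * D \<le> C * m \<alpha>"
proof (rule ccontr)
  assume contr: "\<not> \<alpha> * D \<le> C * m \<alpha>"
  define h where "h x = m x * x powr (- C)" for x
  have h: "h b \<le> h a" if "0 < a" "a \<le> b" for a b
  proof -
    have "b powr (- C) = a powr (- C) * (a / b) powr C"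
      using that by (simp add: powr_divide powr_minus field_simps)
    then have "h b = a powr (- C) * ((a / b) powr C * m b)"
      unfolding h_def by simp
    also have "\<dots> \<le> a powr (- C) * m a"
      using growth[OF that] by (rule mult_left_mono) simp
    finally show ?thesis by (simp add: h_def mult.commute)
  qed
  have "(h has_real_derivative (D * \<alpha> powr (- C) + (- C * \<alpha> powr (- C - 1)) * m \<alpha>)) (at \<alpha>)"
    unfolding h_def by (rule DERIV_mult[OF D has_real_derivative_powr]) fact
  \<comment> \<open>Factoring out the smaller power shows that the derivative of \<open>h\<close>
    has the sign of \<alpha>D - C m(\<alpha>).\<close>
  moreover have "\<alpha> powr (- C) = \<alpha> powr (- C - 1) * \<alpha>"
    using \<open>0 < \<alpha>\<close> by (simp add: powr_diff)
  then have "D * \<alpha> powr (- C) + (- C * \<alpha> powr (- C - 1)) * m \<alpha> = \<alpha> powr (- C - 1) * (\<alpha> * D - C * m \<alpha>)"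
    by (simp only:) (simp add: algebra_simps)
  ultimately have "(h has_real_derivative \<alpha> powr (- C - 1) * (\<alpha> * D - C * m \<alpha>)) (at \<alpha>)"
    by (simp only:)
  moreover have "0 < \<alpha> powr (- C - 1) * (\<alpha> * D - C * m \<alpha>)"
    using contr \<open>0 < \<alpha>\<close> by simp
  ultimately obtain d where "0 < d" and d: "\<forall>x>0. x < d \<longrightarrow> h \<alpha> < h (\<alpha> + x)"
    by (blast dest: DERIV_pos_inc_right)
  then have "h \<alpha> < h (\<alpha> + d / 2)" by simp
  then show False using h[of \<alpha> "\<alpha> + d / 2"] \<open>0 < \<alpha>\<close> \<open>0 < d\<close> by simp
qed

theorem theorem4p1:
  fixes r :: real
  assumes "CARD('n::finite) \<ge> 2"
    and "0 < r" and "r < 1" and "r\<^sup>2 < 1 / 5"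
  shows "(\<forall>\<alpha>>0. \<exists>e>0. \<exists>L. L-lipschitz_on (ball \<alpha> e \<inter> {0<..}) (mu TYPE('n) r)) \<and>
    (\<forall>\<alpha>>0. \<forall>D. (mu TYPE('n) r has_real_derivative D) (at \<alpha>) \<longrightarrow>
       \<alpha> * D \<le> (1 - r\<^sup>2) / (1 - 5 * r\<^sup>2) * mu TYPE('n) r \<alpha>)"
proof -
  let ?C = "(1 - r\<^sup>2) / (1 - 5 * r\<^sup>2)"
  have "r\<^sup>2 < 1 / 3" using assms(4) by simp
  \<comment> \<open>The dilation argument gives the constant with 3 in place of 5; the growth
    inequality holds for every larger \<open>C\<close>, in particular for C(r).\<close>
  have "(1 - r\<^sup>2) / (1 - 3 * r\<^sup>2) \<le> ?C"
    using assms(2,4) by (intro divide_left_mono mult_pos_pos) auto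
  note growth = mu_mono_and_growth[OF \<open>0 < r\<close> \<open>r\<^sup>2 < 1 / 3\<close> _ _ this]
  have "0 < ?C" using assms(4) by (intro divide_pos_pos) auto
  then show ?thesis
    using locally_lipschitz_of_growth[of "mu TYPE('n) r" ?C, OF growth]
      deriv_le_of_growth[of ?C "mu TYPE('n) r", OF growth(2)] by blast
qed

end
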